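(* Let $N\ge1$ and $1<q<\infty$. There is a constant $C=C(q,N)$ depending only on $q$ and $N$ such that for every $u\in BMO(\mathbb{R}^N)$ (inequalities in $[0,\infty]$) $$\|u\|_{B^{1/q}_{q,\infty}(\mathbb{R}^N)}\le C\,[u]_{BV_w(\mathbb{R}^N)}^{\frac1q}\,\|u\|_{BMO(\mathbb{R}^N)}^{1-\frac1q}\le C\,\|u\|_{BV(\mathbb{R}^N)}^{\frac1q}\,\|u\|_{BMO(\mathbb{R}^N)}^{1-\frac1q}.$$ In particular, if $u\in BMO(\mathbb{R}^N)\cap BV_w(\mathbb{R}^N)$, then $u\in B^{1/q}_{q,\infty}(\mathbb{R}^N)$ for every $q\in(1,\infty)$.
   Context: $\mathcal{L}^N$ is Lebesgue measure; $0\cdot\infty:=0$. Define $[f]_{L^1_w(\mathbb{R}^N)}:=\sup_{t>0}t\,\mathcal{L}^N(\{|f|>t\})$; $L^1_w$ is the set of measurable $f$ for which this is finite. For measurable $u:\mathbb{R}^N\to\mathbb{R}$ put $$\|u\|_{BV(\mathbb{R}^N)}:=\sup_{h\ne0}\frac{\|u(\cdot+h)-u\|_{L^1(\mathbb{R}^N)}}{|h|},\qquad [u]_{BV_w(\mathbb{R}^N)}:=\sup_{h\ne0}\frac{[u(\cdot+h)-u]_{L^1_w(\mathbb{R}^N)}}{|h|};$$ $u\in BV(\mathbb{R}^N)$ iff $u\in L^1(\mathbb{R}^N)$ and $\|u\|_{BV(\mathbb{R}^N)}<\infty$; $u\in BV_w(\mathbb{R}^N)$ iff $u\in L^1_w(\mathbb{R}^N)$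 and $[u]_{BV_w(\mathbb{R}^N)}<\infty$. For $1<q<\infty$, $$\|u\|_{B^{1/q}_{q,\infty}(\mathbb{R}^N)}:=\sup_{t>0}\ t^{-1/q}\sup_{|h|\le t}\|u(\cdot+h)-u\|_{L^q(\mathbb{R}^N)}=\sup_{h\neq0}\frac{\|u(\cdot+h)-u\|_{L^q(\mathbb{R}^N)}}{|h|^{1/q}},$$ and $u\in B^{1/q}_{q,\infty}(\mathbb{R}^N)$ iff $u\in L^q(\mathbb{R}^N)$ and this is finite. A cube is a Cartesian product of $N$ non-empty closed bounded intervals of the same (positive) length. For real-valued $u\in L^1_{\mathrm{loc}}(\mathbb{R}^N)$, $u\in BMO(\mathbb{R}^N)$ means that $$\|u\|_{BMO(\mathbb{R}^N)}:=\sup\left\{\frac{1}{\mathcal{L}^N(C)^2}\int_C\int_C|u(z)-u(x)|\,dz\,dx : C\subset \mathbb{R}^N\text{ a cube}\right\}<\infty .$$ *)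

theory Defs
  imports "HOL-Analysis.Analysis"
begin

(* Power of an extended nonnegative real; only used with p > 0, where 0 and \<infinity> are fixed points. *)
definition ennpowr :: "ennreal \<Rightarrow> real \<Rightarrow> ennreal" where
  "ennpowr x p = (if x = \<infinity> then \<infinity> else ennreal (enn2real x powr p))"

definition Lp_norm :: "real \<Rightarrow> (real ^ 'n \<Rightarrow> real) \<Rightarrow> ennreal" where
  "Lp_norm p f = ennpowr (\<integral>\<^sup>+ x. ennreal (\<bar>f x\<bar> powr p) \<partial>lebesgue) (1 / p)"

definition Lp_space :: "real \<Rightarrow> (real ^ 'n \<Rightarrow> real) set" where
  "Lp_space p = {f. f \<in> borel_measurable lebesgue \<and> Lp_norm p f < \<infinity>}"

definition weak_L1_seminorm :: "(real ^ 'n \<Rightarrow> real) \<Rightarrow> ennreal" where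
  "weak_L1_seminorm f = (SUP t\<in>{0<..}. ennreal t * emeasure lebesgue {x. \<bar>f x\<bar> > t})"

definition weak_L1 :: "(real ^ 'n \<Rightarrow> real) set" where
  "weak_L1 = {f. f \<in> borel_measurable lebesgue \<and> weak_L1_seminorm f < \<infinity>}"

definition BV_norm :: "(real ^ 'n \<Rightarrow> real) \<Rightarrow> ennreal" where
  "BV_norm u = (SUP h\<in>-{0}. Lp_norm 1 (\<lambda>x. u (x + h) - u x) / ennreal (norm h))"

definition BVw_seminorm :: "(real ^ 'n \<Rightarrow> real) \<Rightarrow> ennreal" where
  "BVw_seminorm u = (SUP h\<in>-{0}. weak_L1_seminorm (\<lambda>x. u (x + h) - u x) / ennreal (norm h))"

definition BVw :: "(real ^ 'n \<Rightarrow> real) set" where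
  "BVw = {u. u \<in> weak_L1 \<and> BVw_seminorm u < \<infinity>}"

definition besov_norm :: "real \<Rightarrow> (real ^ 'n \<Rightarrow> real) \<Rightarrow> ennreal" where
  "besov_norm q u =
     (SUP t\<in>{0<..}. ennreal (t powr (- (1 / q))) *
        (SUP h\<in>{h. norm h \<le> t}. Lp_norm q (\<lambda>x. u (x + h) - u x)))"

definition besov_space :: "real \<Rightarrow> (real ^ 'n \<Rightarrow> real) set" where
  "besov_space q = {u. u \<in> Lp_space q \<and> besov_norm q u < \<infinity>}"

definition cubes :: "(real ^ 'n) set set" where
  "cubes = {cbox a b | a b. \<exists>l>0. \<forall>i. b $ i - a $ i = l}"

definition L1_loc :: "(real ^ 'n \<Rightarrow> real) set" where
  "L1_loc = {u. u \<in> borel_measurable lebesgue \<and>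
                (\<forall>K. compact K \<longrightarrow> set_integrable lebesgue K u)}"

definition BMO_norm :: "(real ^ 'n \<Rightarrow> real) \<Rightarrow> ennreal" where
  "BMO_norm u =
     (SUP C\<in>cubes. (\<integral>\<^sup>+ x\<in>C. (\<integral>\<^sup>+ z\<in>C. ennreal \<bar>u z - u x\<bar> \<partial>lebesgue) \<partial>lebesgue)
                    / (emeasure lebesgue C)\<^sup>2)"

definition BMO :: "(real ^ 'n \<Rightarrow> real) set" where
  "BMO = {u. u \<in> L1_loc \<and> BMO_norm u < \<infinity>}"

end

theory Submission
  imports Defs "HOL-Real_Asymp.Real_Asymp"
begin

text \<open>
  For an increment \<open>g = u (\<cdot> + h) - u\<close> one interpolates \<open>L\<^sup>q\<close> between weak \<open>L\<^sup>1\<close> and BMO. The key point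
  is that the superlevel measures \<open>D t = |{|g| > t}|\<close>, finite by the weak \<open>L\<^sup>1\<close> bound, satisfy
  \<open>D (t + s) \<le> D t / 2\<close> for \<open>s\<close> a dimensional multiple of the oscillation bound \<open>B\<close>. To see this, enclose
  \<open>{|g| > t}\<close> in an open set \<open>U\<close> of almost the same measure and stop a dyadic subdivision as soon as
  \<open>U\<close> fills the fraction \<open>2 ^ -(N + 1)\<close> of a cell. The stopping cells \<open>Q\<close> are disjoint and cover \<open>U\<close>,
  and at least half of each \<open>Q\<close> lies outside \<open>U\<close>, where \<open>|g| \<le> t\<close>; so the double integral of
  \<open>|g z - g x|\<close> over \<open>Q\<close> is at least \<open>s |Q| |Q \<inter> {|g| > t + s}| / 2\<close>. Hence \<open>D\<close> decays geometrically
  beyond \<open>s\<close>, while below \<open>s\<close> the weak \<open>L\<^sup>1\<close> bound \<open>D t \<le> A / t\<close> suffices because \<open>q > 1\<close>.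
\<close>

declare emeasure_completion [simp del]
  \<comment> \<open>would rewrite \<open>emeasure lebesgue\<close> to \<open>emeasure lborel\<close> of an opaque main part\<close>

section \<open>Dyadic cells\<close>

text \<open>For \<open>L > 0\<close> this is the half-open cube of side \<open>L / 2 ^ k\<close> in
  the dyadic grid, named by a point in it rather than by an integer vector, so that stopping rules
  become functions of points.\<close>

definition dyadic_cell :: "real \<Rightarrow> nat \<Rightarrow> real ^ 'n \<Rightarrow> (real ^ 'n) set" where
  "dyadic_cell L k x = {y. \<forall>i. \<lfloor>2 ^ k * y $ i / L\<rfloor> = \<lfloor>2 ^ k * x $ i / L\<rfloor>}"

lemma self_in_dyadic_cell: "x \<in> dyadic_cell L k x"
  by (simp add: dyadic_cell_def)

lemma dyadic_cell_eq: "y \<in> dyadic_cell L k x \<Longrightarrow> dyadic_cell L k y = dyadic_cell L k x"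
  by (simp add: dyadic_cell_def)

text \<open>The floor of \<open>c\<close> is determined by the floor of \<open>2 * c\<close>, so
  finer floors determine coarser ones.\<close>

lemma dyadic_cell_Suc_subset: "dyadic_cell L (Suc k) x \<subseteq> dyadic_cell L k x"
proof -
  have half: "\<lfloor>c\<rfloor> = \<lfloor>2 * c\<rfloor> div 2" for c :: real
    using floor_divide_real_eq_div[of 2 "2 * c"] by simp
  have "\<lfloor>2 ^ k * c / L\<rfloor> = \<lfloor>2 ^ Suc k * c / L\<rfloor> div 2" for c
    unfolding half[of "2 ^ k * c / L"] by (simp only: power_Suc mult.assoc times_divide_eq_right)
  thus ?thesis
    unfolding dyadic_cell_def by auto
qed

lemma dyadic_cell_antimono: "j \<le> k \<Longrightarrow> dyadic_cell L k x \<subseteq> dyadic_cell L j x"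
  by (rule lift_Suc_antimono_le[where f = "\<lambda>k. dyadic_cell L k x"]) (rule dyadic_cell_Suc_subset)

lemma dyadic_cell_closure:
  fixes x :: "real ^ 'n"
  assumes "L > 0"
  obtains a b where "box a b \<subseteq> dyadic_cell L k x" "dyadic_cell L k x \<subseteq> cbox a b"
    "\<And>i. b $ i - a $ i = L / 2 ^ k"
proof
  let ?a = "\<chi> i. L * of_int \<lfloor>2 ^ k * x $ i / L\<rfloor> / 2 ^ k :: real ^ 'n"
  let ?b = "\<chi> i. L * (of_int \<lfloor>2 ^ k * x $ i / L\<rfloor> + 1) / 2 ^ k :: real ^ 'n"
  show "box ?a ?b \<subseteq> dyadic_cell L k x"
    using assms by (auto simp: dyadic_cell_def mem_box_cart floor_eq_iff field_simps less_imp_le)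
  show "dyadic_cell L k x \<subseteq> cbox ?a ?b"
    using assms by (auto simp: dyadic_cell_def mem_box_cart floor_eq_iff field_simps less_imp_le)
  show "?b $ i - ?a $ i = L / 2 ^ k" for i
    by (simp add: field_simps)
qed

lemma measure_cube:
  fixes a b :: "real ^ 'n"
  assumes "\<And>i. b $ i - a $ i = l" "l \<ge> 0"
  shows "measure lebesgue (cbox a b) = l ^ CARD('n)"
proof -
  have "a $ i \<le> b $ i" for i
    using assms(1)[of i] assms(2) by linarith
  hence "cbox a b \<noteq> {}"
    by (metis interval_ne_empty_cart(1))
  hence "measure lborel (cbox a b) = (\<Prod>i\<in>UNIV. b $ i - a $ i)"
    by (rule content_cbox_cart)
  also have "\<dots> = l ^ CARD('n)"
    by (simp only: assms(1) prod_constant)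
  finally show ?thesis
    by simp
qed

text \<open>Half-open cells can be disjoint, whereas BMO speaks of closed cubes. The two differ
  inside the frontier of a box, which is negligible.\<close>

lemma dyadic_cell_in_cube:
  fixes x :: "real ^ 'n"
  assumes "L > 0"
  obtains C where "C \<in> cubes" "dyadic_cell L k x \<subseteq> C" "C - dyadic_cell L k x \<in> null_sets lebesgue"
    "measure lebesgue C = (L / 2 ^ k) ^ CARD('n)"
proof -
  obtain a b where ab: "box a b \<subseteq> dyadic_cell L k x" "dyadic_cell L k x \<subseteq> cbox a b"
      "\<And>i. b $ i - a $ i = L / 2 ^ k"
    using dyadic_cell_closure[OF assms, of k x] by blast
  have l: "L / 2 ^ k > 0" using assms by simp
  show thesis
  proof
    show "cbox a b \<in> cubes" using ab(3) l unfolding cubes_def by blast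
    have "cbox a b - box a b \<in> null_sets lebesgue"
      using negligible_frontier_interval[of a b] by (simp add: negligible_iff_null_sets)
    then show "cbox a b - dyadic_cell L k x \<in> null_sets lebesgue"
      by (rule null_sets_completion_subset[rotated]) (use ab in auto)
    show "measure lebesgue (cbox a b) = (L / 2 ^ k) ^ CARD('n)"
      using ab(3) l by (intro measure_cube) auto
  qed (use ab in auto)
qed

lemma sets_dyadic_cell [measurable]:
  "dyadic_cell L k (x :: real ^ 'n) \<in> sets lebesgue"
proof -
  have "dyadic_cell L k x \<in> sets borel"
    unfolding dyadic_cell_def by measurable
  thus ?thesis by simp
qed

lemma fmeasurable_cube: "C \<in> cubes \<Longrightarrow> C \<in> lmeasurable"
  by (auto simp: cubes_def)

text \<open>Two points of a cell differ by at most \<open>L / 2 ^ k\<close> in each coordinate, so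
  their distance is at most \<open>CARD('n)\<close> times that, which tends to 0.\<close>

lemma dyadic_cell_subset_open:
  fixes x :: "real ^ 'n"
  assumes "L > 0" "open U" "x \<in> U"
  obtains k where "dyadic_cell L k x \<subseteq> U"
proof -
  obtain e where e: "e > 0" "ball x e \<subseteq> U"
    using assms open_contains_ball by blast
  have "(\<lambda>k. real CARD('n) * (L * (1 / 2) ^ k)) \<longlonglongrightarrow> real CARD('n) * (L * 0)"
    by (intro tendsto_intros LIMSEQ_realpow_zero) auto
  hence "eventually (\<lambda>k. real CARD('n) * (L * (1 / 2) ^ k) < e) sequentially"
    using e by (intro order_tendstoD) auto
  then obtain k where "real CARD('n) * (L * (1 / 2) ^ k) < e"
    unfolding eventually_sequentially by blast
  hence k: "real CARD('n) * (L / 2 ^ k) < e"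
    by (simp only: power_one_over times_divide_eq_right mult_1_right)
  have "y \<in> U" if "y \<in> dyadic_cell L k x" for y
  proof -
    obtain a b where "box a b \<subseteq> dyadic_cell L k x" and ab: "dyadic_cell L k x \<subseteq> cbox a b"
        "\<And>i. b $ i - a $ i = L / 2 ^ k"
      using dyadic_cell_closure[OF assms(1), of k x] by blast
    have "\<bar>(y - x) $ i\<bar> \<le> L / 2 ^ k" for i
    proof -
      have "x \<in> cbox a b" "y \<in> cbox a b"
        using that ab(1) self_in_dyadic_cell[of x L k] by blast+
      hence "a $ i \<le> x $ i" "x $ i \<le> b $ i" "a $ i \<le> y $ i" "y $ i \<le> b $ i"
        by (simp_all add: mem_box_cart)
      thus ?thesis using ab(2)[of i] by (simp add: abs_le_iff)
    qed
    hence "(\<Sum>i\<in>UNIV. \<bar>(y - x) $ i\<bar>) \<le> real CARD('n) * (L / 2 ^ k)"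
      by (intro sum_bounded_above) auto
    hence "norm (y - x) < e"
      using norm_le_l1_cart[of "y - x"] k by linarith
    thus ?thesis using e(2) by (auto simp: dist_norm norm_minus_commute)
  qed
  thus thesis using that by blast
qed

section \<open>Decay of superlevel measures\<close>

text \<open>Each point of \<open>U\<close> stops at the first level whose cell is dense in
  \<open>U\<close>. Such a level exists because small cells lie inside the open set
  \<open>U\<close>, and it is never 0 because \<open>L\<close> is large. Density of the stopping
  cell gives the last bound, failure of density at its parent gives the half.\<close>

lemma calderon_zygmund_cubes:
  fixes U :: "(real ^ 'n) set"
  assumes "open U" "U \<in> lmeasurable"
  obtains F where "countable F" "disjoint F" "U \<subseteq> \<Union>F" "F \<subseteq> sets lebesgue"
    "\<forall>Q\<in>F. \<exists>C\<in>cubes. Q \<subseteq> C \<and> 2 * measure lebesgue (C \<inter> U) \<le> measure lebesgue C \<and>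
             measure lebesgue C \<le> 2 ^ (CARD('n) + 1) * measure lebesgue (Q \<inter> U)"
proof -
  let ?\<mu> = "measure lebesgue" and ?N = "CARD('n)"
  \<comment> \<open>A parent has \<open>2 ^ N\<close> times the volume of its child. With this
    threshold, a parent that is not dense meets \<open>U\<close> in at most half the volume of the
    child.\<close>
  define \<theta> :: real where "\<theta> = 1 / 2 ^ (?N + 1)"
  \<comment> \<open>Makes \<open>\<theta> * L\<close> at least the measure of \<open>U\<close>; the
    summand 1 ensures \<open>L \<ge> 1\<close>, hence \<open>L \<le> L ^ N\<close>, so that no cell
    of level 0 is dense.\<close>
  define L where "L = ?\<mu> U / \<theta> + 1"
  have \<theta>: "\<theta> > 0" by (simp add: \<theta>_def)
  have L: "L \<ge> 1" using \<theta> by (simp add: L_def)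
  define dense where "dense k x \<longleftrightarrow> ?\<mu> (dyadic_cell L k x \<inter> U) > \<theta> * (L / 2 ^ k) ^ ?N" for k and x :: "real ^ 'n"
  define level where "level x = (LEAST k. dense k x)" for x
  define cell where "cell x = dyadic_cell L (level x) x" for x
  have U_sets: "U \<in> sets lebesgue" using assms(2) by (rule fmeasurableD)
  have fm: "A \<inter> U \<in> lmeasurable" if "A \<in> sets lebesgue" for A
    using fmeasurable_Int_fmeasurable[OF assms(2) that] by (simp add: Int_commute)
  have dense_cong: "dense j y = dense j x" if "y \<in> dyadic_cell L k x" "j \<le> k" for j k x y
  proof -
    have "dyadic_cell L j y = dyadic_cell L j x"
      using that dyadic_cell_antimono[of j k L x] by (intro dyadic_cell_eq) auto
    thus ?thesis by (simp add: dense_def)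
  qed
  have dense_level: "dense (level x) x" if "x \<in> U" for x
  proof -
    obtain k where k: "dyadic_cell L k x \<subseteq> U"
      using dyadic_cell_subset_open[OF _ assms(1) \<open>x \<in> U\<close>, of L] L by auto
    obtain C where C: "dyadic_cell L k x \<subseteq> C" "C - dyadic_cell L k x \<in> null_sets lebesgue"
        "?\<mu> C = (L / 2 ^ k) ^ ?N"
      using dyadic_cell_in_cube[of L k x] L by auto
    have "?\<mu> C = ?\<mu> (dyadic_cell L k x \<union> (C - dyadic_cell L k x))"
      using C(1) by (metis Diff_partition)
    also have "\<dots> = ?\<mu> (dyadic_cell L k x)"
      by (rule measure_Un_null_set) (use C(2) in auto)
    finally have "?\<mu> (dyadic_cell L k x \<inter> U) = (L / 2 ^ k) ^ ?N"
      using k C(3) by (simp add: Int_absorb2)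
    moreover have "\<theta> < 1"
      using one_less_power[of "2 :: real" "?N + 1"] by (simp add: \<theta>_def)
    moreover have "(L / 2 ^ k) ^ ?N > 0" using L by simp
    ultimately have "dense k x"
      unfolding dense_def by (metis mult_strict_right_mono mult_1)
    thus ?thesis unfolding level_def by (rule LeastI)
  qed
  have not_dense_0: "\<not> dense 0 x" for x
  proof -
    have "?\<mu> (dyadic_cell L 0 x \<inter> U) \<le> ?\<mu> U"
      by (intro measure_mono_fmeasurable) (use assms(2) in auto)
    also have "?\<mu> U \<le> \<theta> * L"
      using \<theta> by (simp add: L_def field_simps)
    also have "L ^ 1 \<le> L ^ ?N"
      using L by (intro power_increasing) (auto simp: Suc_le_eq)
    hence "\<theta> * L \<le> \<theta> * L ^ ?N" using \<theta> by simp
    finally show ?thesis by (simp add: dense_def)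
  qed
  \<comment> \<open>Density at levels up to \<open>level x\<close> takes the same values at all
    points of \<open>cell x\<close>, so they all stop at the same level. Disjointness of distinct
    stopping cells follows.\<close>
  have cell_eq: "cell y = cell x" if "y \<in> cell x" "x \<in> U" for x y
  proof -
    have y: "y \<in> dyadic_cell L (level x) x" using that by (simp add: cell_def)
    have "level y = level x"
      unfolding level_def[of y]
    proof (rule Least_equality)
      show "dense (level x) y"
        using dense_level[OF that(2)] dense_cong[OF y order_refl] by blast
      show "level x \<le> j" if "dense j y" for j
      proof (rule ccontr)
        assume "\<not> level x \<le> j"
        hence "j < level x" by simp
        with dense_cong[OF y, of j] that have "dense j x" by simp
        with \<open>j < level x\<close> show False unfolding level_def using not_less_Least by blast
      qed
    qed
    thus ?thesis using dyadic_cell_eq[OF y] by (simp add: cell_def)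
  qed
  have cell_self: "x \<in> cell x" for x by (simp add: cell_def self_in_dyadic_cell)
  show thesis
  proof (rule that[of "cell ` U"])
    show "disjoint (cell ` U)"
    proof (rule disjointI)
      fix A B assume "A \<in> cell ` U" "B \<in> cell ` U" "A \<noteq> B"
      then obtain x y where xy: "x \<in> U" "y \<in> U" "A = cell x" "B = cell y" by blast
      with \<open>A \<noteq> B\<close> cell_eq show "A \<inter> B = {}" by blast
    qed
    \<comment> \<open>A cell depends only on its level and its integer vector of floors, and since
      \<open>'n\<close> is finite there are countably many such pairs.\<close>
    define G where "G = (\<lambda>(k :: nat, m :: 'n \<Rightarrow> int). {y :: real ^ 'n. \<forall>i. \<lfloor>2 ^ k * y $ i / L\<rfloor> = m i})"
    have "cell x = G (level x, \<lambda>i. \<lfloor>2 ^ level x * x $ i / L\<rfloor>)" for x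
      by (simp add: G_def cell_def dyadic_cell_def)
    hence "cell ` U \<subseteq> range G"
      by auto
    thus "countable (cell ` U)"
      by (rule countable_subset) simp
    show "U \<subseteq> \<Union>(cell ` U)" using cell_self by blast
    show "cell ` U \<subseteq> sets lebesgue" by (auto simp: cell_def)
    show "\<forall>Q\<in>cell ` U. \<exists>C\<in>cubes. Q \<subseteq> C \<and> 2 * ?\<mu> (C \<inter> U) \<le> ?\<mu> C \<and>
             ?\<mu> C \<le> 2 ^ (?N + 1) * ?\<mu> (Q \<inter> U)"
    proof
      fix Q assume "Q \<in> cell ` U"
      then obtain x where x: "x \<in> U" and Q: "Q = cell x" by blast
      obtain k where k: "level x = Suc k"
        using dense_level[OF x] not_dense_0[of x] by (cases "level x") auto
      have Q': "Q = dyadic_cell L (Suc k) x" by (simp add: Q cell_def k)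
      obtain C where C: "C \<in> cubes" "Q \<subseteq> C" "C - Q \<in> null_sets lebesgue"
          "?\<mu> C = (L / 2 ^ Suc k) ^ ?N"
        using dyadic_cell_in_cube[of L "Suc k" x] L Q' by auto
      have "\<not> dense k x"
        using k not_less_Least[of k "\<lambda>k. dense k x"] by (simp add: level_def)
      hence "?\<mu> (dyadic_cell L k x \<inter> U) \<le> \<theta> * (L / 2 ^ k) ^ ?N"
        by (simp add: dense_def)
      \<comment> \<open>The parent, of level \<open>k\<close>, has side twice that of
        \<open>C\<close>.\<close>
      moreover have "\<theta> * (L / 2 ^ k) ^ ?N = ?\<mu> C / 2"
        by (simp add: \<theta>_def C(4) power_divide power_mult_distrib)
      moreover have "?\<mu> (Q \<inter> U) \<le> ?\<mu> (dyadic_cell L k x \<inter> U)"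
        using dyadic_cell_Suc_subset[of L k x] unfolding Q'
        by (intro measure_mono_fmeasurable fm) (auto simp: U_sets)
      moreover have "?\<mu> (C \<inter> U) = ?\<mu> (Q \<inter> U)"
      proof -
        have "?\<mu> (C \<inter> U) = ?\<mu> (Q \<inter> U \<union> (C - Q) \<inter> U)"
          by (rule arg_cong[of _ _ ?\<mu>]) (use C(2) in auto)
        also have "\<dots> = ?\<mu> (Q \<inter> U)"
          using C(3) assms unfolding Q' by (intro measure_Un_null_set null_set_Int2) auto
        finally show ?thesis .
      qed
      ultimately have "2 * ?\<mu> (C \<inter> U) \<le> ?\<mu> C" by linarith
      moreover have "\<theta> * ?\<mu> C < ?\<mu> (Q \<inter> U)"
        using dense_level[OF x] unfolding dense_def k by (simp add: Q' C(4))
      hence "?\<mu> C \<le> 2 ^ (?N + 1) * ?\<mu> (Q \<inter> U)"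
        by (simp add: \<theta>_def field_simps)
      ultimately show "\<exists>C\<in>cubes. Q \<subseteq> C \<and> 2 * ?\<mu> (C \<inter> U) \<le> ?\<mu> C \<and> ?\<mu> C \<le> 2 ^ (?N + 1) * ?\<mu> (Q \<inter> U)"
        using C by blast
    qed
  qed
qed

text \<open>Countable additivity, written as an integral over \<open>count_space F\<close>, turns
  the estimate on each cell into a global one.\<close>

lemma emeasure_le_on_countable_partition:
  assumes "countable F" "disjoint F" "F \<subseteq> sets M" "A \<in> sets M" "B \<in> sets M" "A \<subseteq> \<Union>F"
    and le: "\<And>Q. Q \<in> F \<Longrightarrow> emeasure M (A \<inter> Q) \<le> c * emeasure M (B \<inter> Q)"
  shows "emeasure M A \<le> c * emeasure M B"
proof -
  have dis: "disjoint_family_on (\<lambda>Q. E \<inter> Q) F" for E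
    using assms(2) by (auto simp: disjoint_family_on_def disjoint_def pairwise_def disjnt_def)
  have "emeasure M A = emeasure M (\<Union>Q\<in>F. A \<inter> Q)"
    using assms(6) by (intro arg_cong[of _ _ "emeasure M"]) auto
  also have "\<dots> = (\<integral>\<^sup>+Q. emeasure M (A \<inter> Q) \<partial>count_space F)"
    using assms by (intro emeasure_UN_countable dis) auto
  also have "\<dots> \<le> (\<integral>\<^sup>+Q. c * emeasure M (B \<inter> Q) \<partial>count_space F)"
    by (intro nn_integral_mono le) auto
  also have "\<dots> = c * (\<integral>\<^sup>+Q. emeasure M (B \<inter> Q) \<partial>count_space F)"
    by (intro nn_integral_cmult) auto
  also have "(\<integral>\<^sup>+Q. emeasure M (B \<inter> Q) \<partial>count_space F) = emeasure M (\<Union>Q\<in>F. B \<inter> Q)"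
    using assms by (intro emeasure_UN_countable[symmetric] dis) auto
  also have "c * emeasure M (\<Union>Q\<in>F. B \<inter> Q) \<le> c * emeasure M B"
    using assms(5) by (intro mult_left_mono emeasure_mono) auto
  finally show ?thesis .
qed

text \<open>Restrict the outer variable to \<open>A\<close> and the inner one to \<open>D\<close>;
  there the integrand is at least \<open>s\<close>.\<close>

lemma oscillation_lower_bound:
  fixes g :: "real ^ 'n \<Rightarrow> real"
  assumes "C \<in> sets lebesgue" "A \<in> sets lebesgue" "D \<in> sets lebesgue"
    and sep: "\<And>x z. x \<in> A \<Longrightarrow> z \<in> D \<Longrightarrow> s \<le> \<bar>g z - g x\<bar>"
  shows "ennreal s * emeasure lebesgue (C \<inter> D) * emeasure lebesgue (C \<inter> A)
           \<le> (\<integral>\<^sup>+x\<in>C. (\<integral>\<^sup>+z\<in>C. ennreal \<bar>g z - g x\<bar> \<partial>lebesgue) \<partial>lebesgue)"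
proof -
  have "ennreal s * emeasure lebesgue (C \<inter> D) * emeasure lebesgue (C \<inter> A)
      = (\<integral>\<^sup>+x. ennreal s * emeasure lebesgue (C \<inter> D) * indicator (C \<inter> A) x \<partial>lebesgue)"
    using assms by (subst nn_integral_cmult_indicator) auto
  also have "\<dots> \<le> (\<integral>\<^sup>+x\<in>C. (\<integral>\<^sup>+z\<in>C. ennreal \<bar>g z - g x\<bar> \<partial>lebesgue) \<partial>lebesgue)"
  proof (rule nn_integral_mono)
    fix x
    show "ennreal s * emeasure lebesgue (C \<inter> D) * indicator (C \<inter> A) x
        \<le> (\<integral>\<^sup>+z\<in>C. ennreal \<bar>g z - g x\<bar> \<partial>lebesgue) * indicator C x"
    proof (cases "x \<in> C \<inter> A")
      case True
      have "ennreal s * emeasure lebesgue (C \<inter> D) = (\<integral>\<^sup>+z. ennreal s * indicator (C \<inter> D) z \<partial>lebesgue)"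
        using assms by (subst nn_integral_cmult_indicator) auto
      also have "\<dots> \<le> (\<integral>\<^sup>+z\<in>C. ennreal \<bar>g z - g x\<bar> \<partial>lebesgue)"
        using sep True by (intro nn_integral_mono) (auto simp: indicator_def intro!: ennreal_leI)
      finally show ?thesis using True by simp
    qed simp
  qed
  finally show ?thesis .
qed

lemma measure_cube_pos: "C \<in> cubes \<Longrightarrow> measure lebesgue C > 0"
  for C :: "(real ^ 'n) set"
  using measure_cube unfolding cubes_def
  by (smt (verit, best) mem_Collect_eq zero_less_power)

lemma sets_superlevel:
  fixes f :: "'a :: euclidean_space \<Rightarrow> real"
  assumes [measurable]: "f \<in> borel_measurable lebesgue"
  shows "{x. \<bar>f x\<bar> > t} \<in> sets lebesgue"
proof -
  have "{x \<in> space lebesgue. \<bar>f x\<bar> > t} \<in> sets lebesgue" by measurable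
  thus ?thesis by simp
qed

lemma superlevel_measure_halves:
  fixes g :: "real ^ 'n \<Rightarrow> real"
  assumes [measurable]: "g \<in> borel_measurable lebesgue" and "B > 0"
    and osc: "\<And>C. C \<in> cubes \<Longrightarrow>
      (\<integral>\<^sup>+x\<in>C. (\<integral>\<^sup>+z\<in>C. ennreal \<bar>g z - g x\<bar> \<partial>lebesgue) \<partial>lebesgue) \<le> ennreal B * (emeasure lebesgue C)\<^sup>2"
    and fin: "emeasure lebesgue {x. \<bar>g x\<bar> > t} < \<infinity>"
  shows "emeasure lebesgue {x. \<bar>g x\<bar> > t + 2 ^ (CARD('n) + 3) * B}
           \<le> ennreal (1 / 2) * emeasure lebesgue {x. \<bar>g x\<bar> > t}"
proof -
  let ?\<mu> = "measure lebesgue" and ?N = "CARD('n)"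
  \<comment> \<open>Of the factor \<open>2 ^ (N + 3)\<close>, one 2 pays for using only the half of
    the cube outside \<open>U\<close>, \<open>2 ^ (N + 1)\<close> for the passage from the cube to
    \<open>Q \<inter> U\<close>, and the last 2 yields the halving.\<close>
  define s where "s = 2 ^ (?N + 3) * B"
  define E where "E = {x. \<bar>g x\<bar> > t}"
  define E' where "E' = {x. \<bar>g x\<bar> > t + s}"
  have s: "s > 0" using assms(2) by (simp add: s_def)
  have E: "E \<in> sets lebesgue" and E': "E' \<in> sets lebesgue"
    unfolding E_def E'_def by (intro sets_superlevel assms)+
  have "E' \<subseteq> E" using s by (auto simp: E_def E'_def)
  \<comment> \<open>The stopping argument needs an open set, but \<open>E\<close> is merely
    measurable. Enlarging it to an open \<open>U\<close> costs \<open>\<delta>\<close>, which is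
    removed at the end.\<close>
  have approx: "emeasure lebesgue E' \<le> ennreal (1 / 2) * emeasure lebesgue E + ennreal \<delta>" if \<delta>: "\<delta> > 0" for \<delta>
  proof -
    obtain U where U: "open U" "E \<subseteq> U" "U - E \<in> lmeasurable" "emeasure lebesgue (U - E) < ennreal \<delta>"
      using sets_lebesgue_outer_open[OF E \<delta>] by blast
    have U_sets [measurable]: "U \<in> sets lebesgue" using U(1) by auto
    have "E \<in> lmeasurable" using E fin by (auto simp: fmeasurable_def E_def)
    hence U_fin: "U \<in> lmeasurable"
      using U(2,3) by (metis Diff_partition fmeasurable.Un)
    obtain F where F: "countable F" "disjoint F" "U \<subseteq> \<Union>F" "F \<subseteq> sets lebesgue"
      and cube: "\<forall>Q\<in>F. \<exists>C\<in>cubes. Q \<subseteq> C \<and> 2 * ?\<mu> (C \<inter> U) \<le> ?\<mu> C \<and>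
             ?\<mu> C \<le> 2 ^ (?N + 1) * ?\<mu> (Q \<inter> U)"
      using calderon_zygmund_cubes[OF U(1) U_fin] by blast
    have "emeasure lebesgue E' \<le> ennreal (1 / 2) * emeasure lebesgue U"
    proof (rule emeasure_le_on_countable_partition[OF F(1,2,4) E' U_sets])
      show "E' \<subseteq> \<Union>F" using \<open>E' \<subseteq> E\<close> U(2) F(3) by (meson order_trans)
      fix Q assume Q: "Q \<in> F"
      then obtain C where C: "C \<in> cubes" "Q \<subseteq> C" "2 * ?\<mu> (C \<inter> U) \<le> ?\<mu> C"
          "?\<mu> C \<le> 2 ^ (?N + 1) * ?\<mu> (Q \<inter> U)"
        using cube by blast
      have C_fin: "C \<in> lmeasurable" using C(1) by (rule fmeasurable_cube)
      have Q_sets: "Q \<in> sets lebesgue" using Q F(4) by blast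
      have fm: "A \<inter> D \<in> lmeasurable" "C - D \<in> lmeasurable"
        if "A \<in> lmeasurable" "D \<in> sets lebesgue" for A D :: "(real ^ 'n) set"
        using that C_fin by (auto intro: fmeasurable_Int_fmeasurable fmeasurable_Diff)
      have em: "emeasure lebesgue A = ennreal (?\<mu> A)" if "A \<in> lmeasurable" for A :: "(real ^ 'n) set"
        using that by (rule emeasure_eq_measure2)
      have "ennreal s * emeasure lebesgue (C \<inter> - U) * emeasure lebesgue (C \<inter> E')
          \<le> ennreal B * (emeasure lebesgue C)\<^sup>2"
      proof (rule order_trans[OF oscillation_lower_bound osc[OF C(1)]])
        show "s \<le> \<bar>g z - g x\<bar>" if "x \<in> E'" "z \<in> - U" for x z
        proof -
          have "z \<notin> E" using that(2) U(2) by blast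
          hence "\<bar>g z\<bar> \<le> t" by (simp add: E_def)
          with that(1) show ?thesis unfolding E'_def by auto
        qed
      qed (use C_fin E' U_sets in \<open>auto simp: Compl_in_sets_lebesgue\<close>)
      hence "ennreal (s * ?\<mu> (C - U) * ?\<mu> (C \<inter> E')) \<le> ennreal (B * (?\<mu> C)\<^sup>2)"
        using s assms(2) fm[OF C_fin U_sets] fm[OF C_fin E'] C_fin
        by (simp add: em ennreal_mult ennreal_power Diff_eq)
      hence "s * ?\<mu> (C - U) * ?\<mu> (C \<inter> E') \<le> B * (?\<mu> C)\<^sup>2"
        using assms(2) by simp
      moreover have "?\<mu> (C - U) \<ge> ?\<mu> C / 2"
      proof -
        have "?\<mu> (C - C \<inter> U) = ?\<mu> C - ?\<mu> (C \<inter> U)"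
          using C_fin fm(1)[OF C_fin U_sets] by (intro measurable_measure_Diff) auto
        moreover have "C - C \<inter> U = C - U" by blast
        ultimately have "?\<mu> (C - U) = ?\<mu> C - ?\<mu> (C \<inter> U)" by simp
        thus ?thesis using C(3) by simp
      qed
      hence "s * (?\<mu> C / 2) * ?\<mu> (C \<inter> E') \<le> s * ?\<mu> (C - U) * ?\<mu> (C \<inter> E')"
        using s by (intro mult_right_mono mult_left_mono) auto
      ultimately have "s * (?\<mu> C / 2) * ?\<mu> (C \<inter> E') \<le> B * (?\<mu> C)\<^sup>2"
        by linarith
      \<comment> \<open>Isolates one factor \<open>?\<mu> C\<close>, which is positive and can be
        cancelled.\<close>
      hence "?\<mu> C * (s / 2 * ?\<mu> (C \<inter> E')) \<le> ?\<mu> C * (B * ?\<mu> C)"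
        by (simp add: power2_eq_square mult_ac)
      hence "s / 2 * ?\<mu> (C \<inter> E') \<le> B * ?\<mu> C"
        using measure_cube_pos[OF C(1)] by simp
      also have "\<dots> \<le> B * (2 ^ (?N + 1) * ?\<mu> (Q \<inter> U))"
        using C(4) assms(2) by (intro mult_left_mono) auto
      finally have "(2 ^ (?N + 2) * B) * ?\<mu> (C \<inter> E') \<le> (2 ^ (?N + 2) * B) * (?\<mu> (Q \<inter> U) / 2)"
        by (simp add: s_def power_add mult_ac)
      hence "?\<mu> (C \<inter> E') \<le> ?\<mu> (Q \<inter> U) / 2"
        using assms(2) by (subst (asm) mult_le_cancel_left_pos) auto
      moreover have "?\<mu> (E' \<inter> Q) \<le> ?\<mu> (C \<inter> E')"
        using C(2) E' Q_sets fm(1)[OF C_fin E'] by (intro measure_mono_fmeasurable) auto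
      ultimately have "?\<mu> (E' \<inter> Q) \<le> 1 / 2 * ?\<mu> (U \<inter> Q)"
        by (simp add: Int_commute)
      moreover have "E' \<inter> Q \<in> lmeasurable"
        by (rule fmeasurableI2[OF fm(1)[OF C_fin E']]) (use C(2) E' Q_sets in auto)
      moreover have "U \<inter> Q \<in> lmeasurable" using fm(1)[OF U_fin Q_sets] .
      ultimately show "emeasure lebesgue (E' \<inter> Q) \<le> ennreal (1 / 2) * emeasure lebesgue (U \<inter> Q)"
        by (simp add: em ennreal_mult[symmetric] ennreal_leI del: ennreal_half)
    qed
    also have "emeasure lebesgue U \<le> emeasure lebesgue E + emeasure lebesgue (U - E)"
      using emeasure_subadditive[of E lebesgue "U - E"] E U(2,3) by (simp add: Un_absorb1 fmeasurableD)
    also have "emeasure lebesgue E + emeasure lebesgue (U - E) \<le> emeasure lebesgue E + ennreal \<delta>"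
      using U(4) by (intro add_left_mono) auto
    also have "ennreal (1 / 2) * (emeasure lebesgue E + ennreal \<delta>)
        \<le> ennreal (1 / 2) * emeasure lebesgue E + ennreal \<delta>"
    proof -
      have "ennreal (1 / 2) * ennreal \<delta> \<le> ennreal \<delta>"
        using \<delta> by (subst ennreal_mult[symmetric]) auto
      thus ?thesis by (simp add: distrib_left add_left_mono)
    qed
    finally show ?thesis by (simp add: mult_left_mono)
  qed
  have "emeasure lebesgue E' \<le> ennreal (1 / 2) * emeasure lebesgue E"
    by (rule ennreal_le_epsilon) (rule approx)
  thus ?thesis by (simp add: E_def E'_def s_def)
qed

section \<open>Summation over layers\<close>

text \<open>Any ratio strictly between 1/2 and 1 dominates; with 3/4 the remaining factor
  \<open>(2 / 3) ^ k\<close> absorbs the power of \<open>k\<close>.\<close>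

lemma summable_powr_half_power: "summable (\<lambda>k. (real k + 2) powr q * (1 / 2) ^ k)"
proof (rule summable_comparison_test_bigo)
  show "summable (\<lambda>k. norm ((3 / 4 :: real) ^ k))" by (simp add: summable_geometric)
  show "(\<lambda>k. (real k + 2) powr q * (1 / 2) ^ k) \<in> O(\<lambda>k. (3 / 4) ^ k)"
    by real_asymp
qed

text \<open>Every \<open>y > 0\<close> lies in one layer, whose upper end bounds it. Above
  \<open>s\<close> the layers have length \<open>s\<close>, to match halving at each step
  \<open>s\<close>; below \<open>s\<close> they are dyadic, to match a bound of the form
  \<open>A / t\<close>.\<close>

lemma powr_le_layer_sum:
  fixes y s q :: real
  assumes "y \<ge> 0" "s > 0" "q > 0"
  shows "ennreal (y powr q) \<le>
    (\<Sum>k. ennreal (((real k + 2) * s) powr q) * indicator {(real k + 1) * s<..} y) +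
    (\<Sum>k. ennreal ((s / 2 ^ k) powr q) * indicator {s / 2 ^ Suc k<..} y)"
proof -
  have term_le: "f k \<le> suminf f" for f :: "nat \<Rightarrow> ennreal" and k
    using sum_le_suminf[of f "{k}"] by simp
  consider "y = 0" | "y > s" | "0 < y" "y \<le> s" using assms by linarith
  thus ?thesis
  proof cases
    case 2
    \<comment> \<open>Chosen so that \<open>k + 1 < y / s \<le> k + 2\<close>. As
      \<open>y / s > 1\<close>, the ceiling is at least 2 and \<open>nat\<close> truncates
      nothing.\<close>
    define k where "k = nat (\<lceil>y / s\<rceil> - 2)"
    have "y / s > 1" using 2 assms by simp
    hence "\<lceil>y / s\<rceil> \<ge> 2" by linarith
    hence "real k + 2 = of_int \<lceil>y / s\<rceil>" by (simp add: k_def)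
    hence "y / s \<le> real k + 2" "real k + 1 < y / s" by linarith+
    hence k: "y \<le> (real k + 2) * s" "(real k + 1) * s < y" using assms by (auto simp: field_simps)
    have "ennreal (y powr q) \<le> ennreal (((real k + 2) * s) powr q) * indicator {(real k + 1) * s<..} y"
      using k assms by (auto intro!: ennreal_leI powr_mono2)
    also have "\<dots> \<le> (\<Sum>k. ennreal (((real k + 2) * s) powr q) * indicator {(real k + 1) * s<..} y)"
      by (rule term_le)
    finally show ?thesis by (rule order_trans) simp
  next
    case 3
    have "eventually (\<lambda>k. s * (1 / 2) ^ k < y) sequentially"
    proof (rule order_tendstoD)
      show "(\<lambda>k. s * (1 / 2) ^ k) \<longlonglongrightarrow> s * 0" by (intro tendsto_intros LIMSEQ_realpow_zero) auto
    qed (use 3 in auto)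
    hence ex: "\<exists>k. s * (1 / 2) ^ k < y" unfolding eventually_sequentially by blast
    \<comment> \<open>The layer sought has index \<open>m - 1\<close>; \<open>m\<close> is not 0
      because \<open>y \<le> s\<close>.\<close>
    define m where "m = (LEAST k. s * (1 / 2) ^ k < y)"
    have m: "s * (1 / 2) ^ m < y" unfolding m_def by (rule LeastI_ex[OF ex])
    with 3 have "m \<noteq> 0" by (intro notI) simp
    then obtain k where k: "m = Suc k" using not0_implies_Suc by blast
    have "\<not> s * (1 / 2) ^ k < y"
      using k not_less_Least[of k "\<lambda>k. s * (1 / 2) ^ k < y"] by (simp add: m_def)
    hence le: "y \<le> s / 2 ^ k" "s / 2 ^ Suc k < y" using m by (auto simp: k power_divide)
    have "ennreal (y powr q) \<le> ennreal ((s / 2 ^ k) powr q) * indicator {s / 2 ^ Suc k<..} y"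
      using le assms by (auto intro!: ennreal_leI powr_mono2)
    also have "\<dots> \<le> (\<Sum>k. ennreal ((s / 2 ^ k) powr q) * indicator {s / 2 ^ Suc k<..} y)"
      by (rule term_le)
    finally show ?thesis by (rule order_trans) simp
  qed simp
qed

text \<open>The series collects the layers above \<open>s\<close>. The second summand is the
  geometric series of the layers below \<open>s\<close>, with ratio less than 1 when
  \<open>q > 1\<close>; its 2 arises from using the weak bound at the lower end of a dyadic
  layer.\<close>

definition interpolation_const :: "real \<Rightarrow> real" where
  "interpolation_const q = (\<Sum>k. (real k + 2) powr q * (1 / 2) ^ k) + 2 / (1 - (1 / 2) powr (q - 1))"

text \<open>Integrating the layer bound term by term leaves two series in the superlevel measures.
  Each is \<open>A * s powr (q - 1)\<close> times a convergent numerical series.\<close>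

lemma nn_integral_powr_le_layers:
  fixes g :: "'a \<Rightarrow> real"
  assumes [measurable]: "g \<in> borel_measurable M" and s: "s > 0" and q: "q > 1" and A: "A \<ge> 0"
    and weak: "\<And>t. t > 0 \<Longrightarrow> emeasure M {x \<in> space M. \<bar>g x\<bar> > t} \<le> ennreal (A / t)"
    and halves: "\<And>t. t > 0 \<Longrightarrow> emeasure M {x \<in> space M. \<bar>g x\<bar> > t + s}
                   \<le> ennreal (1 / 2) * emeasure M {x \<in> space M. \<bar>g x\<bar> > t}"
  shows "(\<integral>\<^sup>+x. ennreal (\<bar>g x\<bar> powr q) \<partial>M) \<le> ennreal (interpolation_const q * A * s powr (q - 1))"
proof -
  define D where "D t = emeasure M {x \<in> space M. \<bar>g x\<bar> > t}" for t
  \<comment> \<open>The weak bound at \<open>s\<close> starts the induction, and each further step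
    of length \<open>s\<close> halves.\<close>
  have D_large: "D ((real k + 1) * s) \<le> ennreal ((1 / 2) ^ k * (A / s))" for k
  proof (induction k)
    case 0
    show ?case using weak[OF s] by (simp add: D_def)
  next
    case (Suc k)
    have "D ((real (Suc k) + 1) * s) = D ((real k + 1) * s + s)" by (simp add: algebra_simps)
    also have "\<dots> \<le> ennreal (1 / 2) * D ((real k + 1) * s)"
      unfolding D_def using s by (intro halves) (simp add: add_nonneg_pos)
    also have "\<dots> \<le> ennreal (1 / 2) * ennreal ((1 / 2) ^ k * (A / s))"
      by (intro mult_left_mono Suc.IH) simp
    also have "\<dots> = ennreal ((1 / 2) ^ Suc k * (A / s))"
      using A s by (subst ennreal_mult[symmetric]) (auto simp: mult.assoc)
    finally show ?case .
  qed
  have layer: "(\<integral>\<^sup>+x. ennreal c * indicator {t<..} \<bar>g x\<bar> \<partial>M) = ennreal c * D t" for c t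
  proof -
    have "(\<integral>\<^sup>+x. ennreal c * indicator {t<..} \<bar>g x\<bar> \<partial>M)
        = (\<integral>\<^sup>+x. ennreal c * indicator {x \<in> space M. \<bar>g x\<bar> > t} x \<partial>M)"
      by (intro nn_integral_cong) (auto simp: indicator_def)
    also have "\<dots> = ennreal c * D t"
      unfolding D_def by (rule nn_integral_cmult_indicator) measurable
    finally show ?thesis .
  qed
  let ?S1 = "\<lambda>k. (real k + 2) powr q * (1 / 2) ^ k"
  let ?r = "(1 / 2 :: real) powr (q - 1)"
  have r: "0 < ?r" "?r < 1" using q powr01_less_one[of "1 / 2" "q - 1"] by simp_all
  have large: "(\<Sum>k. ennreal (((real k + 2) * s) powr q) * D ((real k + 1) * s))
      \<le> ennreal (suminf ?S1 * (A * s powr (q - 1)))"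
  proof -
    have "ennreal (((real k + 2) * s) powr q) * D ((real k + 1) * s)
        \<le> ennreal (?S1 k * (A * s powr (q - 1)))" for k
    proof -
      have "ennreal (((real k + 2) * s) powr q) * D ((real k + 1) * s)
          \<le> ennreal (((real k + 2) * s) powr q) * ennreal ((1 / 2) ^ k * (A / s))"
        by (intro mult_left_mono D_large) simp
      also have "\<dots> = ennreal (((real k + 2) * s) powr q * ((1 / 2) ^ k * (A / s)))"
        using A s by (intro ennreal_mult[symmetric]) auto
      also have "((real k + 2) * s) powr q * ((1 / 2) ^ k * (A / s)) = ?S1 k * (A * s powr (q - 1))"
        using s by (simp add: powr_mult powr_diff)
      finally show ?thesis .
    qed
    hence "(\<Sum>k. ennreal (((real k + 2) * s) powr q) * D ((real k + 1) * s))
        \<le> (\<Sum>k. ennreal (?S1 k * (A * s powr (q - 1))))"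
      by (intro suminf_le) auto
    also have "\<dots> = ennreal (\<Sum>k. ?S1 k * (A * s powr (q - 1)))"
      using A by (intro suminf_ennreal2 summable_mult2 summable_powr_half_power) auto
    also have "(\<Sum>k. ?S1 k * (A * s powr (q - 1))) = suminf ?S1 * (A * s powr (q - 1))"
      by (rule suminf_mult2[symmetric]) (rule summable_powr_half_power)
    finally show ?thesis .
  qed
  have small: "(\<Sum>k. ennreal ((s / 2 ^ k) powr q) * D (s / 2 ^ Suc k))
      \<le> ennreal (2 / (1 - ?r) * (A * s powr (q - 1)))"
  proof -
    \<comment> \<open>Dividing by the lower end \<open>s / 2 ^ Suc k\<close> lowers the exponent to
      \<open>q - 1\<close> at the cost of a factor 2.\<close>
    have "ennreal ((s / 2 ^ k) powr q) * D (s / 2 ^ Suc k) \<le> ennreal (?r ^ k * (2 * A * s powr (q - 1)))" for k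
    proof -
      have "ennreal ((s / 2 ^ k) powr q) * D (s / 2 ^ Suc k)
          \<le> ennreal ((s / 2 ^ k) powr q) * ennreal (A / (s / 2 ^ Suc k))"
        unfolding D_def using s by (intro mult_left_mono weak) auto
      also have "\<dots> = ennreal ((s / 2 ^ k) powr q * (A / (s / 2 ^ Suc k)))"
        using A s by (intro ennreal_mult[symmetric]) auto
      also have "(s / 2 ^ k) powr q * (A / (s / 2 ^ Suc k)) = 2 * A * (s / 2 ^ k) powr (q - 1)"
        using s by (simp add: powr_diff)
      also have "(s / 2 ^ k) powr (q - 1) = ?r ^ k * s powr (q - 1)"
      proof -
        have "(s / 2 ^ k) powr (q - 1) = s powr (q - 1) * ((1 / 2) ^ k) powr (q - 1)"
          using s by (subst powr_mult[symmetric]) (auto simp: power_divide)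
        also have "((1 / 2 :: real) ^ k) powr (q - 1) = ?r ^ k"
          by (simp add: powr_realpow[symmetric] powr_powr mult.commute)
        finally show ?thesis by (simp add: mult.commute)
      qed
      finally show ?thesis by (simp add: mult_ac)
    qed
    hence "(\<Sum>k. ennreal ((s / 2 ^ k) powr q) * D (s / 2 ^ Suc k))
        \<le> (\<Sum>k. ennreal (?r ^ k * (2 * A * s powr (q - 1))))"
      by (intro suminf_le) auto
    also have "\<dots> = ennreal (\<Sum>k. ?r ^ k * (2 * A * s powr (q - 1)))"
      using A r by (intro suminf_ennreal2 summable_mult2 summable_geometric) auto
    also have "(\<Sum>k. ?r ^ k * (2 * A * s powr (q - 1))) = 1 / (1 - ?r) * (2 * A * s powr (q - 1))"
      using r by (subst suminf_mult2[symmetric]) (auto simp: summable_geometric suminf_geometric)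
    finally show ?thesis by (simp add: mult_ac)
  qed
  have "(\<integral>\<^sup>+x. ennreal (\<bar>g x\<bar> powr q) \<partial>M) \<le> (\<integral>\<^sup>+x.
      (\<Sum>k. ennreal (((real k + 2) * s) powr q) * indicator {(real k + 1) * s<..} \<bar>g x\<bar>) +
      (\<Sum>k. ennreal ((s / 2 ^ k) powr q) * indicator {s / 2 ^ Suc k<..} \<bar>g x\<bar>) \<partial>M)"
    using s q by (intro nn_integral_mono powr_le_layer_sum) auto
  also have "\<dots> = (\<Sum>k. ennreal (((real k + 2) * s) powr q) * D ((real k + 1) * s)) +
      (\<Sum>k. ennreal ((s / 2 ^ k) powr q) * D (s / 2 ^ Suc k))"
    by (simp add: nn_integral_add nn_integral_suminf layer del: power_Suc)
  also have "\<dots> \<le> ennreal (suminf ?S1 * (A * s powr (q - 1))) + ennreal (2 / (1 - ?r) * (A * s powr (q - 1)))"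
    by (intro add_mono large small)
  also have "\<dots> = ennreal (interpolation_const q * A * s powr (q - 1))"
  proof -
    have "0 \<le> suminf ?S1" by (intro suminf_nonneg summable_powr_half_power) auto
    thus ?thesis
      using A r by (subst ennreal_plus[symmetric]) (auto simp: interpolation_const_def algebra_simps)
  qed
  finally show ?thesis .
qed

section \<open>Translations and oscillation\<close>

text \<open>Completion keeps the measure of Borel sets, so a cover for \<open>lborel\<close> still
  serves. Sigma-finiteness makes the inner integral of an oscillation measurable in the outer
  variable.\<close>

lemma sigma_finite_lebesgue: "sigma_finite_measure lebesgue"
proof -
  obtain A :: "'a set set" where "countable A" "A \<subseteq> sets lborel" "\<Union>A = space lborel"
      "\<forall>a\<in>A. emeasure lborel a \<noteq> \<infinity>"
    using lborel.sigma_finite_countable by blast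
  thus ?thesis
    by (intro sigma_finite_measure.intro exI[of _ A]) (auto simp: emeasure_completion)
qed

interpretation lebesgue: sigma_finite_measure lebesgue
  by (rule sigma_finite_lebesgue)

text \<open>A translation is the affine map with all scaling factors 1, whose density factor is
  1.\<close>

lemma
  fixes h :: "'a :: euclidean_space"
  shows measurable_lebesgue_translation [measurable]: "(\<lambda>x. x + h) \<in> lebesgue \<rightarrow>\<^sub>M lebesgue"
    and lebesgue_distr_translation: "distr lebesgue lebesgue (\<lambda>x. x + h) = lebesgue"
proof -
  have T: "h + (\<Sum>j\<in>Basis. (1 * (x \<bullet> j)) *\<^sub>R j) = x + h" for x
    by (simp add: euclidean_representation add.commute)
  show "(\<lambda>x. x + h) \<in> lebesgue \<rightarrow>\<^sub>M lebesgue"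
    using lebesgue_affine_measurable[of "\<lambda>_. 1" h] unfolding T by simp
  show "distr lebesgue lebesgue (\<lambda>x. x + h) = lebesgue"
    using lebesgue_affine_euclidean[of "\<lambda>_. 1" h] unfolding T by (simp add: density_1)
qed

lemma nn_integral_lebesgue_translation:
  fixes f :: "'a :: euclidean_space \<Rightarrow> ennreal"
  assumes "f \<in> borel_measurable lebesgue"
  shows "(\<integral>\<^sup>+x. f (x + h) \<partial>lebesgue) = (\<integral>\<^sup>+x. f x \<partial>lebesgue)"
  using nn_integral_distr[OF measurable_lebesgue_translation[of h], of f] assms
  by (simp add: lebesgue_distr_translation)

lemma AE_lebesgue_translation:
  fixes P :: "'a :: euclidean_space \<Rightarrow> bool"
  assumes "AE x in lebesgue. P x"
  shows "AE x in lebesgue. P (x + h)"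
proof -
  have "AE x in distr lebesgue lebesgue (\<lambda>x. x + h). P x"
    using assms by (simp only: lebesgue_distr_translation)
  thus ?thesis
    by (rule AE_distrD[OF measurable_lebesgue_translation])
qed

section \<open>Oscillation over cubes, and functions of vanishing BMO norm\<close>

text \<open>The BMO quotient without its denominator, so that estimates avoid division in
  \<open>ennreal\<close>.\<close>

definition cube_osc :: "(real ^ 'n \<Rightarrow> real) \<Rightarrow> (real ^ 'n) set \<Rightarrow> ennreal" where
  "cube_osc u C = (\<integral>\<^sup>+x\<in>C. (\<integral>\<^sup>+z\<in>C. ennreal \<bar>u z - u x\<bar> \<partial>lebesgue) \<partial>lebesgue)"

lemma sets_cube: "C \<in> cubes \<Longrightarrow> C \<in> sets lebesgue"
  by (auto simp: cubes_def)

lemma emeasure_cube_sq: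
  fixes C :: "(real ^ 'n) set"
  assumes "C \<in> cubes"
  shows "(emeasure lebesgue C)\<^sup>2 \<noteq> 0" "(emeasure lebesgue C)\<^sup>2 < top"
  using measure_cube_pos[OF assms] emeasure_eq_measure2[OF fmeasurable_cube[OF assms]]
  by (auto simp: ennreal_power)

lemma cube_osc_le_BMO_norm:
  assumes "C \<in> cubes"
  shows "cube_osc u C \<le> BMO_norm u * (emeasure lebesgue C)\<^sup>2"
proof -
  let ?e = "(emeasure lebesgue C)\<^sup>2"
  have "cube_osc u C = cube_osc u C / ?e * ?e"
    using emeasure_cube_sq[OF assms] by (simp add: ennreal_divide_times)
  also have "cube_osc u C / ?e \<le> BMO_norm u"
    unfolding BMO_norm_def cube_osc_def using assms by (rule SUP_upper)
  hence "cube_osc u C / ?e * ?e \<le> BMO_norm u * ?e"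
    by (rule mult_right_mono) simp
  finally show ?thesis .
qed

lemma cube_translation:
  assumes "C \<in> cubes"
  shows "(\<lambda>x. x + h) ` C \<in> cubes" "emeasure lebesgue ((\<lambda>x. x + h) ` C) = emeasure lebesgue C"
proof -
  have im: "(\<lambda>x. x + h) ` C = (+) h ` C" by (auto simp: add.commute)
  obtain a b l where ab: "C = cbox a b" "l > 0" "\<forall>i. b $ i - a $ i = l"
    using assms unfolding cubes_def by blast
  have "(\<lambda>x. x + h) ` C = cbox (h + a) (h + b)"
    unfolding im unfolding ab(1) by (rule cbox_translation[symmetric])
  moreover have "\<forall>i. (h + b) $ i - (h + a) $ i = l" using ab(3) by simp
  ultimately show "(\<lambda>x. x + h) ` C \<in> cubes" using ab(2) unfolding cubes_def by blast
  have "C \<in> lmeasurable" using assms by (rule fmeasurable_cube)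
  thus "emeasure lebesgue ((\<lambda>x. x + h) ` C) = emeasure lebesgue C"
    unfolding im by (simp add: emeasure_eq_measure2 measurable_translation measure_translation)
qed

text \<open>Substitute in both variables; the indicator of \<open>C\<close> at \<open>x\<close> is
  that of the translated cube at \<open>x + h\<close>.\<close>

lemma cube_osc_translation:
  assumes [measurable]: "u \<in> borel_measurable lebesgue" and "C \<in> cubes"
  shows "cube_osc (\<lambda>x. u (x + h)) C = cube_osc u ((\<lambda>x. x + h) ` C)"
proof -
  let ?C = "(\<lambda>x. x + h) ` C"
  have [measurable]: "?C \<in> sets lebesgue" using cube_translation(1)[OF assms(2)] by (rule sets_cube)
  have ind: "indicator C x = (indicator ?C (x + h) :: ennreal)" for x
    by (auto simp: indicator_def)
  have inner: "(\<integral>\<^sup>+z\<in>C. ennreal \<bar>u (z + h) - c\<bar> \<partial>lebesgue) = (\<integral>\<^sup>+z\<in>?C. ennreal \<bar>u z - c\<bar> \<partial>lebesgue)" for c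
    unfolding ind by (rule nn_integral_lebesgue_translation) measurable
  show ?thesis
    unfolding cube_osc_def inner unfolding ind
    by (intro nn_integral_lebesgue_translation) measurable
qed

lemma cube_osc_diff_le:
  assumes [measurable]: "u \<in> borel_measurable lebesgue" "v \<in> borel_measurable lebesgue"
    and C [measurable]: "C \<in> sets lebesgue"
  shows "cube_osc (\<lambda>x. u x - v x) C \<le> cube_osc u C + cube_osc v C"
proof -
  have inner: "(\<integral>\<^sup>+z\<in>C. ennreal \<bar>u z - v z - (u x - v x)\<bar> \<partial>lebesgue)
      \<le> (\<integral>\<^sup>+z\<in>C. ennreal \<bar>u z - u x\<bar> \<partial>lebesgue) + (\<integral>\<^sup>+z\<in>C. ennreal \<bar>v z - v x\<bar> \<partial>lebesgue)" for x
  proof -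
    have "(\<integral>\<^sup>+z\<in>C. ennreal \<bar>u z - v z - (u x - v x)\<bar> \<partial>lebesgue)
        \<le> (\<integral>\<^sup>+z. ennreal \<bar>u z - u x\<bar> * indicator C z + ennreal \<bar>v z - v x\<bar> * indicator C z \<partial>lebesgue)"
      by (intro nn_integral_mono)
        (auto simp: indicator_def ennreal_plus[symmetric] simp del: ennreal_plus intro!: ennreal_leI)
    also have "\<dots> = (\<integral>\<^sup>+z\<in>C. ennreal \<bar>u z - u x\<bar> \<partial>lebesgue) + (\<integral>\<^sup>+z\<in>C. ennreal \<bar>v z - v x\<bar> \<partial>lebesgue)"
      by (rule nn_integral_add) measurable
    finally show ?thesis .
  qed
  have "cube_osc (\<lambda>x. u x - v x) C
      \<le> (\<integral>\<^sup>+x. (\<integral>\<^sup>+z\<in>C. ennreal \<bar>u z - u x\<bar> \<partial>lebesgue) * indicator C x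
            + (\<integral>\<^sup>+z\<in>C. ennreal \<bar>v z - v x\<bar> \<partial>lebesgue) * indicator C x \<partial>lebesgue)"
    unfolding cube_osc_def distrib_right[symmetric]
    by (intro nn_integral_mono mult_right_mono inner) simp
  also have "\<dots> = cube_osc u C + cube_osc v C"
    unfolding cube_osc_def
    by (intro nn_integral_add) measurable
  finally show ?thesis .
qed

text \<open>BMO is translation invariant, so the triangle inequality bounds the oscillation of every
  increment uniformly in \<open>h\<close>.\<close>

lemma cube_osc_increment_le:
  assumes [measurable]: "u \<in> borel_measurable lebesgue" and "C \<in> cubes"
  shows "cube_osc (\<lambda>x. u (x + h) - u x) C \<le> 2 * BMO_norm u * (emeasure lebesgue C)\<^sup>2"
proof -
  have "cube_osc (\<lambda>x. u (x + h) - u x) C \<le> cube_osc (\<lambda>x. u (x + h)) C + cube_osc u C"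
    by (rule cube_osc_diff_le) (use sets_cube[OF assms(2)] in measurable)
  also have "\<dots> = cube_osc u ((\<lambda>x. x + h) ` C) + cube_osc u C"
    using assms by (simp add: cube_osc_translation)
  also have "\<dots> \<le> BMO_norm u * (emeasure lebesgue C)\<^sup>2 + BMO_norm u * (emeasure lebesgue C)\<^sup>2"
    using cube_osc_le_BMO_norm[OF cube_translation(1)[OF assms(2)], of u h]
      cube_osc_le_BMO_norm[OF assms(2), of u]
    by (intro add_mono) (simp_all add: cube_translation(2)[OF assms(2)])
  also have "\<dots> = 2 * BMO_norm u * (emeasure lebesgue C)\<^sup>2"
    by (simp add: mult_2 distrib_right)
  finally show ?thesis .
qed

text \<open>Serves the degenerate case of the interpolation, which otherwise takes a positive
  oscillation bound. On each of countably many growing cubes, almost every \<open>x\<close>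
  satisfies \<open>u z = u x\<close> for almost all \<open>z\<close>; a single good \<open>x\<close>
  in the smallest cube works for all of them.\<close>

lemma AE_constant_if_BMO_norm_eq_0:
  fixes u :: "real ^ 'n \<Rightarrow> real"
  assumes [measurable]: "u \<in> borel_measurable lebesgue" and "BMO_norm u = 0"
  obtains c where "AE x in lebesgue. u x = c"
proof -
  \<comment> \<open>\<open>Suc n\<close> keeps the side positive at \<open>n = 0\<close>.\<close>
  define Q :: "nat \<Rightarrow> (real ^ 'n) set" where "Q n = cbox (\<chi> i. - real (Suc n)) (\<chi> i. real (Suc n))" for n
  have Q: "Q n \<in> cubes" for n
  proof -
    have "\<forall>i. ((\<chi> i. real (Suc n)) :: real ^ 'n) $ i - (\<chi> i. - real (Suc n)) $ i = 2 * real (Suc n)"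
      by simp
    moreover have "2 * real (Suc n) > 0" by simp
    ultimately show ?thesis unfolding Q_def cubes_def by blast
  qed
  have [measurable]: "Q n \<in> sets lebesgue" for n using Q by (rule sets_cube)
  have "AE x in lebesgue. x \<in> Q n \<longrightarrow> (AE z in lebesgue. z \<in> Q n \<longrightarrow> u z = u x)" for n
  proof -
    have meas: "(\<lambda>x. (\<integral>\<^sup>+z\<in>Q n. ennreal \<bar>u z - u x\<bar> \<partial>lebesgue) * indicator (Q n) x)
        \<in> borel_measurable lebesgue"
      by measurable
    have "cube_osc u (Q n) = 0" using cube_osc_le_BMO_norm[OF Q, of u n] assms(2) by simp
    hence "AE x in lebesgue. (\<integral>\<^sup>+z\<in>Q n. ennreal \<bar>u z - u x\<bar> \<partial>lebesgue) * indicator (Q n) x = 0"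
      unfolding cube_osc_def nn_integral_0_iff_AE[OF meas] .
    thus ?thesis
    proof eventually_elim
      case (elim x)
      show ?case
      proof
        assume "x \<in> Q n"
        hence "(\<integral>\<^sup>+z\<in>Q n. ennreal \<bar>u z - u x\<bar> \<partial>lebesgue) = 0" using elim by simp
        hence "AE z in lebesgue. ennreal \<bar>u z - u x\<bar> * indicator (Q n) z = 0"
          by (subst (asm) nn_integral_0_iff_AE) measurable
        thus "AE z in lebesgue. z \<in> Q n \<longrightarrow> u z = u x"
          by eventually_elim (auto simp: indicator_def)
      qed
    qed
  qed
  hence "AE x in lebesgue. \<forall>n. x \<in> Q n \<longrightarrow> (AE z in lebesgue. z \<in> Q n \<longrightarrow> u z = u x)"
    by (simp add: AE_all_countable)
  then obtain Z where Z: "Z \<in> null_sets lebesgue"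
    "\<And>x. x \<notin> Z \<Longrightarrow> \<forall>n. x \<in> Q n \<longrightarrow> (AE z in lebesgue. z \<in> Q n \<longrightarrow> u z = u x)"
    by (auto elim!: AE_E3)
  \<comment> \<open>Positive measure of \<open>Q 0\<close> provides a point outside the exceptional
    set.\<close>
  have "\<not> Q 0 \<subseteq> Z"
  proof
    assume "Q 0 \<subseteq> Z"
    hence "Q 0 \<in> null_sets lebesgue" using Z(1) null_sets_completion_subset by blast
    hence "measure lebesgue (Q 0) = 0" by (simp add: measure_def null_sets_def)
    thus False using measure_cube_pos[OF Q, of 0] by simp
  qed
  then obtain x where x: "x \<in> Q 0" "x \<notin> Z" by blast
  have "Q 0 \<subseteq> Q n" for n
    unfolding Q_def by (rule subset_interval_imp_cart(1)) simp
  hence "\<forall>n. AE z in lebesgue. z \<in> Q n \<longrightarrow> u z = u x"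
    using Z(2)[OF x(2)] x(1) by blast
  hence all: "AE z in lebesgue. \<forall>n. z \<in> Q n \<longrightarrow> u z = u x" unfolding AE_all_countable .
  have "\<exists>n. z \<in> Q n" for z
  proof -
    obtain n where n: "norm z \<le> real n" using real_arch_simple by blast
    have "\<bar>z $ i\<bar> \<le> real (Suc n)" for i
      using component_le_norm_cart[of z i] n by simp
    hence "z \<in> Q n" unfolding Q_def mem_box_cart by (auto simp: abs_le_iff minus_le_iff simp del: of_nat_Suc)
    thus ?thesis ..
  qed
  with all have "AE z in lebesgue. u z = u x" by (auto elim: eventually_mono)
  thus thesis by (rule that)
qed

section \<open>The interpolation inequality\<close>

lemma ennpowr_ennreal: "x \<ge> 0 \<Longrightarrow> ennpowr (ennreal x) p = ennreal (x powr p)"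
  by (simp add: ennpowr_def)

lemma ennpowr_mono:
  assumes "x \<le> y" "p \<ge> 0"
  shows "ennpowr x p \<le> ennpowr y p"
proof (cases "y = \<infinity>")
  case False
  with assms have "x \<noteq> \<infinity>" "enn2real x \<le> enn2real y"
    by (auto simp: top_unique less_top enn2real_mono)
  with False assms show ?thesis
    by (auto simp: ennpowr_def intro!: ennreal_leI powr_mono2)
qed (simp add: ennpowr_def)

lemma Lp_norm_eq_0:
  fixes f :: "real ^ 'n \<Rightarrow> real"
  assumes "AE x in lebesgue. f x = 0"
  shows "Lp_norm p f = 0"
proof -
  \<comment> \<open>\<open>0 powr p\<close> is 0 for every real \<open>p\<close>; the same
    convention settles the outer root.\<close>
  have "(\<integral>\<^sup>+x. ennreal (\<bar>f x\<bar> powr p) \<partial>lebesgue) = (\<integral>\<^sup>+(x :: real ^ 'n). 0 \<partial>lebesgue)"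
    by (rule nn_integral_cong_AE) (use assms in \<open>auto elim: eventually_mono\<close>)
  thus ?thesis by (simp add: Lp_norm_def ennpowr_def)
qed

text \<open>Chebyshev's inequality.\<close>

lemma weak_L1_seminorm_le_Lp_norm_1:
  fixes f :: "real ^ 'n \<Rightarrow> real"
  assumes "f \<in> borel_measurable lebesgue"
  shows "weak_L1_seminorm f \<le> Lp_norm 1 f"
proof -
  have Lp: "Lp_norm 1 f = (\<integral>\<^sup>+x. ennreal \<bar>f x\<bar> \<partial>lebesgue)"
    by (simp add: Lp_norm_def ennpowr_def powr_one' enn2real_nonneg less_top)
  have "ennreal t * emeasure lebesgue {x. \<bar>f x\<bar> > t} \<le> (\<integral>\<^sup>+x. ennreal \<bar>f x\<bar> \<partial>lebesgue)" for t
  proof -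
    have "ennreal t * emeasure lebesgue {x. \<bar>f x\<bar> > t} = (\<integral>\<^sup>+x. ennreal t * indicator {x. \<bar>f x\<bar> > t} x \<partial>lebesgue)"
      by (rule nn_integral_cmult_indicator[symmetric]) (rule sets_superlevel[OF assms])
    also have "\<dots> \<le> (\<integral>\<^sup>+x. ennreal \<bar>f x\<bar> \<partial>lebesgue)"
      by (intro nn_integral_mono) (auto simp: indicator_def intro!: ennreal_leI)
    finally show ?thesis .
  qed
  thus ?thesis unfolding weak_L1_seminorm_def Lp by (intro SUP_least)
qed

lemma borel_measurable_increment:
  fixes u :: "real ^ 'n \<Rightarrow> real"
  assumes [measurable]: "u \<in> borel_measurable lebesgue"
  shows "(\<lambda>x. u (x + h) - u x) \<in> borel_measurable lebesgue"
  by measurable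

lemma BVw_seminorm_le_BV_norm:
  fixes u :: "real ^ 'n \<Rightarrow> real"
  assumes "u \<in> borel_measurable lebesgue"
  shows "BVw_seminorm u \<le> BV_norm u"
  unfolding BVw_seminorm_def BV_norm_def
  by (intro SUP_mono' divide_right_mono_ennreal weak_L1_seminorm_le_Lp_norm_1 borel_measurable_increment assms)

text \<open>The supremum omits \<open>h = 0\<close>, but there the increment vanishes and its
  superlevel sets for \<open>t > 0\<close> are empty.\<close>

lemma weak_L1_seminorm_increment_le:
  fixes u :: "real ^ 'n \<Rightarrow> real"
  shows "weak_L1_seminorm (\<lambda>x. u (x + h) - u x) \<le> BVw_seminorm u * ennreal (norm h)"
proof (cases "h = 0")
  case False
  let ?w = "weak_L1_seminorm (\<lambda>x. u (x + h) - u x)"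
  have "?w / ennreal (norm h) \<le> BVw_seminorm u"
    unfolding BVw_seminorm_def by (rule SUP_upper) (use False in auto)
  hence "?w / ennreal (norm h) * ennreal (norm h) \<le> BVw_seminorm u * ennreal (norm h)"
    by (rule mult_right_mono) simp
  moreover have "?w / ennreal (norm h) * ennreal (norm h) = ?w"
    using False by (simp add: ennreal_divide_times)
  ultimately show ?thesis by simp
qed (auto simp: weak_L1_seminorm_def)

text \<open>\<open>2 ^ (n + 3)\<close> is the factor in the halving step, raised to the power that
  \<open>s\<close> carries in the layer estimate; the outer exponent is the q-th root in the
  norm.\<close>

definition Lq_const :: "real \<Rightarrow> nat \<Rightarrow> real" where
  "Lq_const q n = (interpolation_const q * (2 ^ (n + 3)) powr (q - 1)) powr (1 / q)"

lemma interpolation_const_pos: "q > 1 \<Longrightarrow> interpolation_const q > 0"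
proof -
  assume "q > 1"
  hence "(1 / 2 :: real) powr (q - 1) < 1" using powr01_less_one[of "1 / 2" "q - 1"] by simp
  moreover have "0 \<le> (\<Sum>k. (real k + 2) powr q * (1 / 2) ^ k)"
    by (intro suminf_nonneg summable_powr_half_power) auto
  ultimately show ?thesis by (simp add: interpolation_const_def add_nonneg_pos)
qed

text \<open>The layer estimate applied with the halving step \<open>s = 2 ^ (N + 3) * B\<close>. A
  general \<open>g\<close> allows its use both for increments and for \<open>u\<close>
  itself.\<close>

lemma Lp_norm_le_weak_L1_oscillation:
  fixes g :: "real ^ 'n \<Rightarrow> real"
  assumes g: "g \<in> borel_measurable lebesgue" and q: "q > 1" and A: "A \<ge> 0" and B: "B > 0"
    and weak: "weak_L1_seminorm g \<le> ennreal A"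
    and osc: "\<And>C. C \<in> cubes \<Longrightarrow> cube_osc g C \<le> ennreal B * (emeasure lebesgue C)\<^sup>2"
  shows "Lp_norm q g \<le> ennreal (Lq_const q CARD('n) * A powr (1 / q) * B powr (1 - 1 / q))"
proof -
  let ?m = "2 ^ (CARD('n) + 3) :: real" and ?K = "interpolation_const q"
  have weak': "emeasure lebesgue {x. \<bar>g x\<bar> > t} \<le> ennreal (A / t)" if "t > 0" for t
  proof -
    let ?e = "emeasure lebesgue {x. \<bar>g x\<bar> > t}"
    have "ennreal t * ?e \<le> weak_L1_seminorm g"
      unfolding weak_L1_seminorm_def by (rule SUP_upper) (use that in simp)
    hence "ennreal t * ?e \<le> ennreal A" using weak by (rule order_trans)
    hence "ennreal (1 / t) * (ennreal t * ?e) \<le> ennreal (1 / t) * ennreal A"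
      by (rule mult_left_mono) simp
    moreover have "ennreal (1 / t) * ennreal t = 1"
      using that by (subst ennreal_mult[symmetric]) auto
    hence "ennreal (1 / t) * (ennreal t * ?e) = ?e" by (simp add: mult.assoc[symmetric])
    moreover have "ennreal (1 / t) * ennreal A = ennreal (A / t)"
      using that A by (subst ennreal_mult[symmetric]) auto
    ultimately show ?thesis by simp
  qed
  have "(\<integral>\<^sup>+x. ennreal (\<bar>g x\<bar> powr q) \<partial>lebesgue) \<le> ennreal (?K * A * (?m * B) powr (q - 1))"
  proof (rule nn_integral_powr_le_layers[OF g _ q A])
    show "?m * B > 0" using B by simp
    fix t :: real assume t: "t > 0"
    show "emeasure lebesgue {x \<in> space lebesgue. \<bar>g x\<bar> > t} \<le> ennreal (A / t)"
      using weak'[OF t] by simp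
    \<comment> \<open>The weak bound supplies the finiteness that halving requires.\<close>
    have "emeasure lebesgue {x. \<bar>g x\<bar> > t} < \<infinity>"
      using weak'[OF t] by (rule le_less_trans) simp
    from superlevel_measure_halves[OF g B osc[unfolded cube_osc_def] this]
    show "emeasure lebesgue {x \<in> space lebesgue. \<bar>g x\<bar> > t + ?m * B}
        \<le> ennreal (1 / 2) * emeasure lebesgue {x \<in> space lebesgue. \<bar>g x\<bar> > t}"
      by simp
  qed
  hence "Lp_norm q g \<le> ennpowr (ennreal (?K * A * (?m * B) powr (q - 1))) (1 / q)"
    unfolding Lp_norm_def using q by (intro ennpowr_mono) auto
  also have "\<dots> = ennreal ((?K * A * (?m * B) powr (q - 1)) powr (1 / q))"
    using A interpolation_const_pos[OF q] by (intro ennpowr_ennreal) auto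
  also have "?K * A * (?m * B) powr (q - 1) = (?K * ?m powr (q - 1)) * A * B powr (q - 1)"
    using B by (simp add: powr_mult mult_ac)
  also have "\<dots> powr (1 / q) = Lq_const q CARD('n) * A powr (1 / q) * (B powr (q - 1)) powr (1 / q)"
    using A B interpolation_const_pos[OF q] unfolding Lq_const_def by (subst powr_mult; simp)+
  also have "(B powr (q - 1)) powr (1 / q) = B powr (1 - 1 / q)"
    using q by (simp add: powr_powr diff_divide_distrib)
  finally show ?thesis .
qed

section \<open>From increments to the Besov norm\<close>

text \<open>Powers with exponent \<open>1 / q\<close> are monotone, so the inner supremum is at most
  \<open>t powr (1 / q) * X\<close>, and the weight in \<open>t\<close> cancels.\<close>

lemma besov_norm_le:
  fixes u :: "real ^ 'n \<Rightarrow> real"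
  assumes "q > 0" "X \<ge> 0"
    and "\<And>h. Lp_norm q (\<lambda>x. u (x + h) - u x) \<le> ennreal (norm h powr (1 / q) * X)"
  shows "besov_norm q u \<le> ennreal X"
  unfolding besov_norm_def
proof (rule SUP_least)
  fix t :: real assume "t \<in> {0<..}"
  hence t: "t > 0" by simp
  have "(SUP h\<in>{h. norm h \<le> t}. Lp_norm q (\<lambda>x. u (x + h) - u x)) \<le> ennreal (t powr (1 / q) * X)"
  proof (rule SUP_least)
    fix h :: "real ^ 'n" assume "h \<in> {h. norm h \<le> t}"
    hence "norm h powr (1 / q) * X \<le> t powr (1 / q) * X"
      using assms by (intro mult_right_mono powr_mono2) auto
    with assms(3)[of h] show "Lp_norm q (\<lambda>x. u (x + h) - u x) \<le> ennreal (t powr (1 / q) * X)"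
      by (meson ennreal_leI order_trans)
  qed
  hence "ennreal (t powr - (1 / q)) * (SUP h\<in>{h. norm h \<le> t}. Lp_norm q (\<lambda>x. u (x + h) - u x))
      \<le> ennreal (t powr - (1 / q)) * ennreal (t powr (1 / q) * X)"
    by (rule mult_left_mono) simp
  also have "\<dots> = ennreal (t powr - (1 / q) * (t powr (1 / q) * X))"
    using assms(2) by (intro ennreal_mult[symmetric]) auto
  also have "t powr - (1 / q) * (t powr (1 / q) * X) = X"
    using t by (simp add: mult.assoc[symmetric] powr_add[symmetric])
  finally show "ennreal (t powr - (1 / q)) * (SUP h\<in>{h. norm h \<le> t}. Lp_norm q (\<lambda>x. u (x + h) - u x)) \<le> ennreal X" .
qed

text \<open>Translations preserve null sets, so every increment vanishes almost everywhere.\<close>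

lemma besov_norm_eq_0:
  fixes u :: "real ^ 'n \<Rightarrow> real"
  assumes "q > 0" "AE x in lebesgue. u x = c"
  shows "besov_norm q u = 0"
proof -
  have "Lp_norm q (\<lambda>x. u (x + h) - u x) = 0" for h
  proof (rule Lp_norm_eq_0)
    show "AE x in lebesgue. u (x + h) - u x = 0"
      using AE_lebesgue_translation[OF assms(2), of h] assms(2) by eventually_elim simp
  qed
  hence "besov_norm q u \<le> ennreal 0"
    using assms(1) by (intro besov_norm_le) auto
  thus ?thesis by simp
qed

text \<open>The power of 2 accounts for increments having up to twice the BMO norm of
  \<open>u\<close>.\<close>

definition besov_const :: "real \<Rightarrow> nat \<Rightarrow> real" where
  "besov_const q n = Lq_const q n * 2 powr (1 - 1 / q)"

lemma besov_const_pos: "q > 1 \<Longrightarrow> besov_const q n > 0"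
  using interpolation_const_pos[of q] by (simp add: besov_const_def Lq_const_def)

text \<open>When both seminorms are finite and the BMO norm is positive, interpolate each increment
  with \<open>A = a * norm h\<close> and \<open>B = 2 * b\<close>. The extreme values are treated
  separately because of the convention that 0 times infinity is 0.\<close>

lemma besov_norm_le_BVw_BMO:
  fixes u :: "real ^ 'n \<Rightarrow> real"
  assumes q: "q > 1" and u: "u \<in> borel_measurable lebesgue" and fin: "BMO_norm u < \<infinity>"
  shows "besov_norm q u
    \<le> ennreal (besov_const q CARD('n)) * ennpowr (BVw_seminorm u) (1 / q) * ennpowr (BMO_norm u) (1 - 1 / q)"
    (is "_ \<le> ennreal ?C * _ * _")
proof -
  obtain b where b: "BMO_norm u = ennreal b" "b \<ge> 0"
    using fin by (cases "BMO_norm u") auto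
  consider "b = 0" | "b > 0" "BVw_seminorm u = \<infinity>" | a where "b > 0" "BVw_seminorm u = ennreal a" "a \<ge> 0"
    using b(2) by (cases "BVw_seminorm u") (auto simp: less_eq_real_def)
  thus ?thesis
  proof cases
    \<comment> \<open>The right side is 0 here, so the Besov norm must vanish exactly.\<close>
    case 1
    then obtain c where "AE x in lebesgue. u x = c"
      using AE_constant_if_BMO_norm_eq_0[OF u] b by auto
    thus ?thesis using besov_norm_eq_0[of q u c] q by simp
  next
    \<comment> \<open>A positive BMO factor keeps the product with infinity infinite.\<close>
    case 2
    hence "ennpowr (BMO_norm u) (1 - 1 / q) \<noteq> 0"
      by (simp add: b ennpowr_ennreal)
    hence "ennreal ?C * ennpowr (BVw_seminorm u) (1 / q) * ennpowr (BMO_norm u) (1 - 1 / q) = \<infinity>"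
      using 2 besov_const_pos[OF q, of "CARD('n)"] by (simp add: ennpowr_def ennreal_mult_eq_top_iff)
    thus ?thesis by simp
  next
    case 3
    let ?X = "?C * a powr (1 / q) * b powr (1 - 1 / q)"
    have "besov_norm q u \<le> ennreal ?X"
    proof (rule besov_norm_le)
      show "0 \<le> ?X" using besov_const_pos[OF q, of "CARD('n)"] by simp
      fix h :: "real ^ 'n"
      have "Lp_norm q (\<lambda>x. u (x + h) - u x)
          \<le> ennreal (Lq_const q CARD('n) * (a * norm h) powr (1 / q) * (2 * b) powr (1 - 1 / q))"
      proof (rule Lp_norm_le_weak_L1_oscillation[OF borel_measurable_increment[OF u] q])
        show "weak_L1_seminorm (\<lambda>x. u (x + h) - u x) \<le> ennreal (a * norm h)"
          using weak_L1_seminorm_increment_le[of u h] 3 by (simp add: ennreal_mult)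
        show "cube_osc (\<lambda>x. u (x + h) - u x) C \<le> ennreal (2 * b) * (emeasure lebesgue C)\<^sup>2" if "C \<in> cubes" for C
          using cube_osc_increment_le[OF u that, of h] b by (simp add: ennreal_mult)
      qed (use 3 in auto)
      also have "Lq_const q CARD('n) * (a * norm h) powr (1 / q) * (2 * b) powr (1 - 1 / q) = norm h powr (1 / q) * ?X"
        using 3 by (simp add: besov_const_def powr_mult mult_ac)
      finally show "Lp_norm q (\<lambda>x. u (x + h) - u x) \<le> ennreal (norm h powr (1 / q) * ?X)" .
    qed (use q in simp)
    also have "ennreal ?X = ennreal ?C * ennpowr (BVw_seminorm u) (1 / q) * ennpowr (BMO_norm u) (1 - 1 / q)"
      using 3 b besov_const_pos[OF q, of "CARD('n)"] by (simp add: ennpowr_ennreal ennreal_mult)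
    finally show ?thesis .
  qed
qed

text \<open>The same interpolation applied to \<open>u\<close> itself instead of an
  increment.\<close>

lemma Lp_space_if_weak_L1_BMO:
  fixes u :: "real ^ 'n \<Rightarrow> real"
  assumes q: "q > 1" and u: "u \<in> weak_L1" and fin: "BMO_norm u < \<infinity>"
  shows "u \<in> Lp_space q"
proof -
  have meas: "u \<in> borel_measurable lebesgue" using u by (simp add: weak_L1_def)
  obtain a where a: "weak_L1_seminorm u = ennreal a" "a \<ge> 0"
    using u by (cases "weak_L1_seminorm u") (auto simp: weak_L1_def)
  obtain b where b: "BMO_norm u = ennreal b" "b \<ge> 0"
    using fin by (cases "BMO_norm u") auto
  \<comment> \<open>\<open>b + 1\<close> is a positive oscillation bound even if
    \<open>b = 0\<close>; only finiteness matters.\<close>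
  have "Lp_norm q u \<le> ennreal (Lq_const q CARD('n) * a powr (1 / q) * (b + 1) powr (1 - 1 / q))"
  proof (rule Lp_norm_le_weak_L1_oscillation[OF meas q a(2)])
    show "cube_osc u C \<le> ennreal (b + 1) * (emeasure lebesgue C)\<^sup>2" if "C \<in> cubes" for C
    proof -
      have "cube_osc u C \<le> ennreal b * (emeasure lebesgue C)\<^sup>2"
        using cube_osc_le_BMO_norm[OF that, of u] b by simp
      also have "\<dots> \<le> ennreal (b + 1) * (emeasure lebesgue C)\<^sup>2"
        by (intro mult_right_mono ennreal_leI) auto
      finally show ?thesis .
    qed
  qed (use a b in auto)
  hence "Lp_norm q u < \<infinity>" by (rule le_less_trans) simp
  with meas show ?thesis by (simp add: Lp_space_def)
qed

theorem theorem1p15: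
  shows "(\<forall>q::real. 1 < q \<longrightarrow>
            (\<exists>C::real. C > 0 \<and>
              (\<forall>u :: real ^ 'n \<Rightarrow> real. u \<in> BMO \<longrightarrow>
                 besov_norm q u
                   \<le> ennreal C * ennpowr (BVw_seminorm u) (1 / q) * ennpowr (BMO_norm u) (1 - 1 / q) \<and>
                 ennreal C * ennpowr (BVw_seminorm u) (1 / q) * ennpowr (BMO_norm u) (1 - 1 / q)
                   \<le> ennreal C * ennpowr (BV_norm u) (1 / q) * ennpowr (BMO_norm u) (1 - 1 / q)))) \<and>
         (\<forall>u :: real ^ 'n \<Rightarrow> real. u \<in> BMO \<inter> BVw \<longrightarrow>
            (\<forall>q::real. 1 < q \<longrightarrow> u \<in> besov_space q))"
proof (intro conjI allI impI)
  fix q :: real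
  assume q: "1 < q"
  show "\<exists>C::real. C > 0 \<and>
      (\<forall>u :: real ^ 'n \<Rightarrow> real. u \<in> BMO \<longrightarrow>
         besov_norm q u
           \<le> ennreal C * ennpowr (BVw_seminorm u) (1 / q) * ennpowr (BMO_norm u) (1 - 1 / q) \<and>
         ennreal C * ennpowr (BVw_seminorm u) (1 / q) * ennpowr (BMO_norm u) (1 - 1 / q)
           \<le> ennreal C * ennpowr (BV_norm u) (1 / q) * ennpowr (BMO_norm u) (1 - 1 / q))"
  proof (intro exI[of _ "besov_const q CARD('n)"] conjI allI impI)
    show "besov_const q CARD('n) > 0" using q by (rule besov_const_pos)
    fix u :: "real ^ 'n \<Rightarrow> real"
    assume "u \<in> BMO"
    hence u: "u \<in> borel_measurable lebesgue" "BMO_norm u < \<infinity>"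
      by (auto simp: BMO_def L1_loc_def)
    show "besov_norm q u \<le> ennreal (besov_const q CARD('n)) * ennpowr (BVw_seminorm u) (1 / q) * ennpowr (BMO_norm u) (1 - 1 / q)"
      using q u by (rule besov_norm_le_BVw_BMO)
    show "ennreal (besov_const q CARD('n)) * ennpowr (BVw_seminorm u) (1 / q) * ennpowr (BMO_norm u) (1 - 1 / q)
        \<le> ennreal (besov_const q CARD('n)) * ennpowr (BV_norm u) (1 / q) * ennpowr (BMO_norm u) (1 - 1 / q)"
      using q by (intro mult_right_mono mult_left_mono ennpowr_mono BVw_seminorm_le_BV_norm u) auto
  qed
next
  fix u :: "real ^ 'n \<Rightarrow> real" and q :: real
  assume "u \<in> BMO \<inter> BVw" and q: "1 < q"
  hence u: "u \<in> borel_measurable lebesgue" "BMO_norm u < \<infinity>" "u \<in> weak_L1" "BVw_seminorm u < \<infinity>"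
    by (auto simp: BMO_def L1_loc_def BVw_def)
  have "besov_norm q u < \<infinity>"
    by (rule le_less_trans[OF besov_norm_le_BVw_BMO[OF q u(1,2)]])
      (use u(2,4) in \<open>auto simp: ennpowr_def ennreal_mult_less_top\<close>)
  with Lp_space_if_weak_L1_BMO[OF q u(3,2)] show "u \<in> besov_space q"
    by (simp add: besov_space_def)
qed

end
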